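(* Let $\mathbf{x}(t)$ satisfy the derived ODEs of a PEPA model, $$\frac{\mathrm{d}\mathbf{x}(U,t)}{\mathrm{d}t}=-\sum_{\{l\mid U\in\mathrm{pre}(l)\}}f(\mathbf{x},l)+\sum_{\{l\mid U\in\mathrm{post}(l)\}}f(\mathbf{x},l)\quad\text{for each local derivative }U,$$ with nonnegative initial values, and for each component type $C_i$ let $N_{C_i}=\sum_j\mathbf{x}(C_{i_j},0)$. Then $0\le\mathbf{x}(C_{i_j},t)\le N_{C_i}$ for all $t\ge0$ and all $i,j$. Moreover, if the initial values are positive, then $0<\mathbf{x}(C_{i_j},t)<N_{C_i}$ for all $t\ge0$.
   Context: A PEPA model (positive real rates, no passive rates) has component types $C_1,\dots,C_n$; type $C_i$ has local derivatives $C_{i_1},\dots,C_{i_{d_i}}$. States $\mathbf{x}$ are indexed by local derivatives. With $r_\alpha^{P\to Q}$ the rate of a transition $P\xrightarrow{\alpha}Q$ (between local derivatives of one type) and $r_\alpha(P)=\sum_Q r_\alpha^{P\to Q}$, labelled activities are: for an individual action $\alpha$, $\alpha^{P\to Q}$ with $\mathrm{pre}=\{P\}$, $\mathrm{post}=\{Q\}$, rate function $f(\mathbf{x},\alpha^{P\to Q})=\mathbf{x}[P]r_\alpha^{P\to Q}$; for a shared action $\alpha$ with enabling local derivatives $P_1,\dots,P_k$ (distinct component types), $\alpha^w$ for each $w=(P_1\to Q_1,\dots,P_k\to Q_k)$ with $P_i\xrightarrow{\alpha}Q_i$, $\mathrm{pre}=\{P_1,\dots,P_k\}$, $\mathrm{post}=\{Q_1,\dots,Q_k\}$,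 rate function $f(\mathbf{x},\alpha^w)=\big(\prod_i r_\alpha^{P_i\to Q_i}/r_\alpha(P_i)\big)\min_i\{\mathbf{x}[P_i]r_\alpha(P_i)\}$. No local derivative is in both the pre and post set of a labelled activity.
   Formalization: The strict upper bound x(C_{i_j},t) < N_{C_i} is stated only for component types with at least two local derivatives; with a single local derivative the population is constantly N_{C_i}, so the strict bound fails. *)

theory Defs
  imports Complex_Main "HOL-Library.FuncSet"
begin

text \<open>The pair \<open>(i, j)\<close> stands for the local derivative \<open>C\<^sub>i\<^sub>j\<close>, the \<open>j\<close>-th one of component
  type \<open>C\<^sub>i\<close>; both indices start at 1.\<close>

type_synonym local_deriv = "nat \<times> nat"

text \<open>The value \<open>rate M \<alpha> P Q\<close> is meaningful only if \<open>(P, \<alpha>, Q)\<close> is a transition of \<open>M\<close>.\<close>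

record 'a pepa =
  num_types :: nat
  num_derivs :: "nat \<Rightarrow> nat"
  transitions :: "(local_deriv \<times> 'a \<times> local_deriv) set"
  rate :: "'a \<Rightarrow> local_deriv \<Rightarrow> local_deriv \<Rightarrow> real"
  shared_actions :: "'a set"

definition local_derivs :: "'a pepa \<Rightarrow> local_deriv set" where
  "local_derivs M = {(i, j). i \<in> {1..num_types M} \<and> j \<in> {1..num_derivs M i}}"

definition targets :: "'a pepa \<Rightarrow> 'a \<Rightarrow> local_deriv \<Rightarrow> local_deriv set" where
  "targets M \<alpha> P = {Q. (P, \<alpha>, Q) \<in> transitions M}"

definition enabling :: "'a pepa \<Rightarrow> 'a \<Rightarrow> local_deriv set" where
  "enabling M \<alpha> = {P. targets M \<alpha> P \<noteq> {}}"

definition total_rate :: "'a pepa \<Rightarrow> 'a \<Rightarrow> local_deriv \<Rightarrow> real" where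
  "total_rate M \<alpha> P = (\<Sum>Q\<in>targets M \<alpha> P. rate M \<alpha> P Q)"

text \<open>The label \<open>w = (P\<^sub>1 \<rightarrow> Q\<^sub>1, \<dots>, P\<^sub>k \<rightarrow> Q\<^sub>k)\<close> of a shared activity is the function
  mapping each enabling local derivative \<open>P\<^sub>i\<close> to \<open>Q\<^sub>i\<close>. Taking it from \<open>Pi\<^sub>E\<close> fixes its values
  elsewhere, so that each label is represented exactly once.\<close>

datatype 'a activity =
  Individual 'a local_deriv local_deriv
| Shared 'a "local_deriv \<Rightarrow> local_deriv"

definition activities :: "'a pepa \<Rightarrow> 'a activity set" where
  "activities M =
     {Individual \<alpha> P Q | \<alpha> P Q. \<alpha> \<notin> shared_actions M \<and> (P, \<alpha>, Q) \<in> transitions M} \<union>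
     {Shared \<alpha> w | \<alpha> w. \<alpha> \<in> shared_actions M \<and> w \<in> Pi\<^sub>E (enabling M \<alpha>) (targets M \<alpha>)}"

fun pre :: "'a pepa \<Rightarrow> 'a activity \<Rightarrow> local_deriv set" where
  "pre M (Individual \<alpha> P Q) = {P}"
| "pre M (Shared \<alpha> w) = enabling M \<alpha>"

fun post :: "'a pepa \<Rightarrow> 'a activity \<Rightarrow> local_deriv set" where
  "post M (Individual \<alpha> P Q) = {Q}"
| "post M (Shared \<alpha> w) = w ` enabling M \<alpha>"

fun rate_fun :: "'a pepa \<Rightarrow> (local_deriv \<Rightarrow> real) \<Rightarrow> 'a activity \<Rightarrow> real" where
  "rate_fun M x (Individual \<alpha> P Q) = x P * rate M \<alpha> P Q"
| "rate_fun M x (Shared \<alpha> w) =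
     (\<Prod>P\<in>enabling M \<alpha>. rate M \<alpha> P (w P) / total_rate M \<alpha> P) *
     Min ((\<lambda>P. x P * total_rate M \<alpha> P) ` enabling M \<alpha>)"

text \<open>The condition \<open>inj_on fst\<close> says that the local derivatives enabling a shared action belong
  to distinct component types.\<close>

definition pepa_model :: "'a pepa \<Rightarrow> bool" where
  "pepa_model M \<longleftrightarrow>
     finite (transitions M) \<and>
     (\<forall>(P, \<alpha>, Q)\<in>transitions M.
        P \<in> local_derivs M \<and> Q \<in> local_derivs M \<and> fst P = fst Q \<and> rate M \<alpha> P Q > 0) \<and>
     (\<forall>\<alpha>\<in>shared_actions M. card (enabling M \<alpha>) \<ge> 2 \<and> inj_on fst (enabling M \<alpha>)) \<and>
     (\<forall>l\<in>activities M. pre M l \<inter> post M l = {})"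

definition derived_ode_rhs :: "'a pepa \<Rightarrow> (local_deriv \<Rightarrow> real) \<Rightarrow> local_deriv \<Rightarrow> real" where
  "derived_ode_rhs M x U =
     - (\<Sum>l\<in>{l \<in> activities M. U \<in> pre M l}. rate_fun M x l)
     + (\<Sum>l\<in>{l \<in> activities M. U \<in> post M l}. rate_fun M x l)"

definition satisfies_derived_odes :: "'a pepa \<Rightarrow> (real \<Rightarrow> local_deriv \<Rightarrow> real) \<Rightarrow> bool" where
  "satisfies_derived_odes M x \<longleftrightarrow>
     (\<forall>t\<ge>0. \<forall>U\<in>local_derivs M.
        ((\<lambda>s. x s U) has_real_derivative derived_ode_rhs M (x t) U) (at t within {0..}))"

definition initial_population :: "'a pepa \<Rightarrow> (real \<Rightarrow> local_deriv \<Rightarrow> real) \<Rightarrow> nat \<Rightarrow> real" where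
  "initial_population M x i = (\<Sum>j=1..num_derivs M i. x 0 (i, j))"

text \<open>A component type with a single local derivative has a constant population, equal to its
  initial one, so a strict upper bound needs at least two local derivatives. The following lemma
  shows that one transition of the type suffices for this. The grammar of PEPA, having no
  terminated component, gives every local derivative a transition.\<close>

lemma two_le_num_derivs:
  assumes M: "pepa_model M" and i: "(i, j) \<in> local_derivs M"
    and tr: "(i, j) \<in> enabling M \<alpha>"
  shows "2 \<le> num_derivs M i"
proof -
  obtain Q where Q: "((i, j), \<alpha>, Q) \<in> transitions M"
    using tr by (auto simp: enabling_def targets_def)
  have loc: "Q \<in> local_derivs M" "fst Q = i"
    using M Q unfolding pepa_model_def by fastforce+
  have disj: "\<And>l. l \<in> activities M \<Longrightarrow> pre M l \<inter> post M l = {}"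
    using M by (auto simp: pepa_model_def)
  have "Q \<noteq> (i, j)"
  proof
    assume eq: "Q = (i, j)"
    show False
    proof (cases "\<alpha> \<in> shared_actions M")
      case False
      then have "Individual \<alpha> (i, j) Q \<in> activities M"
        using Q unfolding activities_def by blast
      from disj[OF this] eq show False by simp
    next
      case True
      define w where "w = (\<lambda>P\<in>enabling M \<alpha>. if P = (i, j) then Q else SOME R. R \<in> targets M \<alpha> P)"
      have "w \<in> Pi\<^sub>E (enabling M \<alpha>) (targets M \<alpha>)"
        using Q by (auto simp: w_def enabling_def targets_def intro: someI)
      then have "Shared \<alpha> w \<in> activities M"
        using True by (auto simp: activities_def)
      from disj[OF this] have "w (i, j) \<noteq> (i, j)" using tr by force
      then show False using tr eq by (simp add: w_def)
    qed
  qed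
  then obtain j' where "Q = (i, j')" "j' \<noteq> j" using loc by (cases Q) auto
  then show ?thesis using loc i by (auto simp: local_derivs_def)
qed

end

theory Submission imports Defs "HOL-Analysis.Convex"
begin

text \<open>Each activity consuming \<open>U\<close> has a rate of at most a constant times \<open>x U\<close>, whatever the sign of
  \<open>x\<close>, and each activity producing \<open>U\<close> has a rate of at least minus a constant times the total
  negative part \<open>\<Sum>P. max 0 (- x P)\<close>. Hence \<open>V = \<Sum>U. (min (x U) 0)\<^sup>2\<close> satisfies \<open>V' \<le> c * V\<close> and
  \<open>V 0 = 0\<close>, so \<open>V\<close> vanishes by Gronwall's inequality. Once \<open>x \<ge> 0\<close> is known, \<open>x U' \<ge> - K * x U\<close>
  gives \<open>x t U \<ge> x 0 U * exp (- K * t)\<close>. The upper bounds follow because each activity moves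
  individuals within their component types, which keeps the population of each type constant.\<close>

section \<open>Differential inequalities on the half-line\<close>

lemma gronwall_halfline:
  fixes u :: "real \<Rightarrow> real"
  assumes u: "\<And>t. t \<ge> 0 \<Longrightarrow> (u has_real_derivative u' t) (at t within {0..})"
    and le: "\<And>t. t \<ge> 0 \<Longrightarrow> u' t \<le> c * u t" and "t \<ge> 0"
  shows "u t \<le> u 0 * exp (c * t)"
proof -
  \<comment> \<open>Integrating factor: the sign of \<open>u' - c * u\<close> makes \<open>g\<close>
    nonincreasing. No sign of \<open>c\<close> enters, so negative \<open>c\<close> and
    \<open>c = 0\<close> are covered.\<close>
  define g where "g s = u s * exp (- c * s)" for s
  have g: "(g has_real_derivative (u' s - c * u s) * exp (- c * s)) (at s within {0..})"
    if "s \<ge> 0" for s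
    unfolding g_def
    by (rule derivative_eq_intros u[OF that] refl)+ (simp add: algebra_simps)
  have "g t \<le> g 0"
  proof (rule DERIV_nonpos_imp_decreasing_open[OF \<open>t \<ge> 0\<close>])
    fix s :: real assume "0 < s" "s < t"
    \<comment> \<open>At interior points the one-sided derivative becomes a two-sided one; at the
      endpoint 0 continuity is enough for the monotonicity rule.\<close>
    have "(g has_real_derivative (u' s - c * u s) * exp (- c * s)) (at s within {0<..})"
      by (rule DERIV_subset[OF g]) (use \<open>0 < s\<close> in auto)
    moreover have "at s within {0<..} = at s"
      by (rule at_within_open) (use \<open>0 < s\<close> in auto)
    moreover have "(u' s - c * u s) * exp (- c * s) \<le> 0"
      using le[of s] \<open>0 < s\<close> by (simp add: mult_nonpos_nonneg)
    ultimately show "\<exists>y. (g has_real_derivative y) (at s) \<and> y \<le> 0" by auto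
  next
    have "continuous_on {0..} g" by (rule DERIV_continuous_on) (use g in auto)
    then show "continuous_on {0..t} g" by (rule continuous_on_subset) auto
  qed
  then have "g t * exp (c * t) \<le> u 0 * exp (c * t)" by (simp add: g_def)
  moreover have "g t * exp (c * t) = u t" by (simp add: g_def exp_minus)
  ultimately show ?thesis by simp
qed

text \<open>Squaring removes the kink of \<open>min y 0\<close> at 0, so the sum of squared negative
  parts can be differentiated by the ordinary chain rule.\<close>

lemma has_real_derivative_min_zero_square:
  "((\<lambda>y::real. (min y 0)\<^sup>2) has_real_derivative 2 * min y 0) (at y)"
proof (cases y "0::real" rule: linorder_cases)
  case less
  have "((\<lambda>y::real. y\<^sup>2) has_real_derivative 2 * y) (at y)"
    by (auto intro!: derivative_eq_intros)
  then have "((\<lambda>y::real. (min y 0)\<^sup>2) has_real_derivative 2 * y) (at y)"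
    by (rule has_field_derivative_transform_within_open[where S = "{..<0}"])
       (use less in \<open>auto simp: min_def\<close>)
  then show ?thesis using less by (simp add: min_def)
next
  case equal
  show ?thesis
    \<comment> \<open>Caratheodory's criterion at 0: \<open>(min z 0)\<^sup>2 = min z 0 * z\<close>,
      with the continuous slope \<open>min z 0\<close> vanishing at 0.\<close>
    unfolding CARAT_DERIV equal
  proof (intro exI[of _ "\<lambda>z. min z 0"] conjI allI)
    show "isCont (\<lambda>z::real. min z 0) 0" by (intro continuous_intros)
  qed (auto simp: power2_eq_square min_def)
next
  case greater
  have "((\<lambda>y::real. 0) has_real_derivative 0) (at y)" by simp
  then have "((\<lambda>y::real. (min y 0)\<^sup>2) has_real_derivative 0) (at y)"
    by (rule has_field_derivative_transform_within_open[where S = "{0<..}"])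
       (use greater in \<open>auto simp: min_def\<close>)
  then show ?thesis using greater by (simp add: min_def)
qed

text \<open>Where \<open>x t U\<close> is negative, the \<open>K\<close> term of the bound pushes it
  upwards, so only the negative parts in the \<open>L\<close> term can drive it further down. Their
  effect is quadratic in the negative parts, hence controlled by \<open>V\<close> itself.\<close>

lemma quasi_positive_nonneg:
  fixes x f :: "real \<Rightarrow> 'b \<Rightarrow> real"
  assumes A: "finite A"
    and ode: "\<And>t U. t \<ge> 0 \<Longrightarrow> U \<in> A \<Longrightarrow> ((\<lambda>s. x s U) has_real_derivative f t U) (at t within {0..})"
    and K: "\<And>U. U \<in> A \<Longrightarrow> 0 \<le> K U" and L: "\<And>U. U \<in> A \<Longrightarrow> 0 \<le> L U"
    and ge: "\<And>t U. t \<ge> 0 \<Longrightarrow> U \<in> A \<Longrightarrow> - K U * x t U - L U * (\<Sum>P\<in>A. max 0 (- x t P)) \<le> f t U"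
    and init: "\<And>U. U \<in> A \<Longrightarrow> 0 \<le> x 0 U"
    and "t \<ge> 0" "U \<in> A"
  shows "0 \<le> x t U"
proof -
  define V where "V t = (\<Sum>U\<in>A. (min (x t U) 0)\<^sup>2)" for t
  define L0 where "L0 = (\<Sum>U\<in>A. L U)"
  have V: "(V has_real_derivative (\<Sum>U\<in>A. 2 * min (x t U) 0 * f t U)) (at t within {0..})"
    if "t \<ge> 0" for t
    unfolding V_def
    by (rule DERIV_sum, rule DERIV_chain2[OF has_real_derivative_min_zero_square ode[OF that]])
  have "(\<Sum>U\<in>A. 2 * min (x t U) 0 * f t U) \<le> (2 * L0 * card A) * V t" if "t \<ge> 0" for t
  proof -
    let ?n = "\<lambda>U. max 0 (- x t U)"
    let ?S = "\<Sum>P\<in>A. ?n P"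
    have S: "0 \<le> ?S" by (simp add: sum_nonneg)
    \<comment> \<open>If \<open>x t U\<close> is nonnegative, both sides vanish; otherwise
      \<open>?n U = - x t U\<close>, and multiplying the lower bound on \<open>f t U\<close> by the
      negative \<open>x t U\<close> reverses it.\<close>
    have "2 * min (x t U) 0 * f t U \<le> 2 * L0 * ?S * ?n U" if "U \<in> A" for U
    proof (cases "x t U \<ge> 0")
      case True
      then show ?thesis by (simp add: min_def max_def)
    next
      case False
      have "L U \<le> L0" unfolding L0_def by (rule member_le_sum) (use that A L in auto)
      then have "L U * ?S \<le> L0 * ?S" using S by (rule mult_right_mono)
      moreover have "K U * x t U \<le> 0" using K[OF that] False by (simp add: mult_nonneg_nonpos)
      ultimately have "- (L0 * ?S) \<le> f t U" using ge[OF \<open>t \<ge> 0\<close> that] by linarith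
      then have "x t U * f t U \<le> x t U * (- (L0 * ?S))" using False by (intro mult_left_mono_neg) auto
      then show ?thesis using False by (simp add: min_def max_def algebra_simps)
    qed
    then have "(\<Sum>U\<in>A. 2 * min (x t U) 0 * f t U) \<le> (\<Sum>U\<in>A. 2 * L0 * ?S * ?n U)"
      by (rule sum_mono)
    also have "\<dots> = 2 * L0 * ?S\<^sup>2" by (simp add: power2_eq_square flip: sum_distrib_left)
    \<comment> \<open>Cauchy-Schwarz turns the square of the sum into \<open>card A\<close> times
      the sum of squares, which closes the estimate in terms of \<open>V t\<close>.\<close>
    also have "\<dots> \<le> 2 * L0 * (real (card A) * (\<Sum>U\<in>A. (?n U)\<^sup>2))"
      using sum_squared_le_sum_of_squares[of ?n A] L
      by (intro mult_left_mono) (auto simp: L0_def sum_nonneg mult.commute)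
    also have "(\<Sum>U\<in>A. (?n U)\<^sup>2) = V t"
      unfolding V_def by (rule sum.cong) (auto simp: min_def max_def)
    finally show ?thesis by (simp add: mult.assoc)
  qed
  then have "V t \<le> V 0 * exp (2 * L0 * card A * t)"
    using gronwall_halfline[OF V _ \<open>t \<ge> 0\<close>] by simp
  moreover have "V 0 = 0" unfolding V_def by (rule sum.neutral) (simp add: init)
  ultimately have "V t \<le> 0" by simp
  moreover have "(min (x t U) 0)\<^sup>2 \<le> V t"
    unfolding V_def by (rule member_le_sum) (use \<open>U \<in> A\<close> A in auto)
  ultimately have "(min (x t U) 0)\<^sup>2 \<le> 0" by linarith
  then show ?thesis by (simp add: min_def split: if_splits)
qed

section \<open>Finiteness and sign facts for PEPA models\<close>

lemma finite_local_derivs: "finite (local_derivs M)"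
proof -
  have "local_derivs M = (SIGMA i:{1..num_types M}. {1..num_derivs M i})"
    by (auto simp: local_derivs_def)
  then show ?thesis by simp
qed

lemma pepa_modelD:
  assumes "pepa_model M"
  shows "finite (transitions M)"
    and "\<forall>(P, \<alpha>, Q)\<in>transitions M.
      P \<in> local_derivs M \<and> Q \<in> local_derivs M \<and> fst P = fst Q \<and> rate M \<alpha> P Q > 0"
    and "\<forall>\<alpha>\<in>shared_actions M. card (enabling M \<alpha>) \<ge> 2 \<and> inj_on fst (enabling M \<alpha>)"
  using assms unfolding pepa_model_def by - (elim conjE, assumption)+

lemma pepa_model_transitionD:
  assumes "pepa_model M" "(P, \<alpha>, Q) \<in> transitions M"
  shows "P \<in> local_derivs M" "Q \<in> local_derivs M" "fst P = fst Q" "rate M \<alpha> P Q > 0"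
  using bspec[OF pepa_modelD(2)[OF assms(1)] assms(2)] by simp_all

lemma enabling_subset:
  assumes "pepa_model M"
  shows "enabling M \<alpha> \<subseteq> local_derivs M"
  by (auto simp: enabling_def targets_def dest: pepa_model_transitionD(1)[OF assms])

lemma targets_subset:
  assumes "pepa_model M"
  shows "targets M \<alpha> P \<subseteq> local_derivs M"
  by (auto simp: targets_def dest: pepa_model_transitionD(2)[OF assms])

lemma finite_targets: "pepa_model M \<Longrightarrow> finite (targets M \<alpha> P)"
  using targets_subset finite_local_derivs by (rule finite_subset)

lemma finite_enabling: "pepa_model M \<Longrightarrow> finite (enabling M \<alpha>)"
  using enabling_subset finite_local_derivs by (rule finite_subset)

text \<open>This guarantees that the \<open>Min\<close> in the rate of a shared activity ranges over
  a nonempty set.\<close>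

lemma enabling_shared_nonempty: "pepa_model M \<Longrightarrow> \<alpha> \<in> shared_actions M \<Longrightarrow> enabling M \<alpha> \<noteq> {}"
  by (auto dest!: pepa_modelD(3))

lemma finite_activities:
  assumes M: "pepa_model M"
  shows "finite (activities M)"
proof -
  let ?S = "(\<lambda>(P, \<alpha>, Q). \<alpha>) ` transitions M"
  have "activities M \<subseteq> (\<lambda>(P, \<alpha>, Q). Individual \<alpha> P Q) ` transitions M \<union>
      (\<Union>\<alpha>\<in>?S. Shared \<alpha> ` Pi\<^sub>E (enabling M \<alpha>) (targets M \<alpha>))"
  proof
    fix l assume "l \<in> activities M"
    then consider (ind) \<alpha> P Q where "l = Individual \<alpha> P Q" "(P, \<alpha>, Q) \<in> transitions M"
      | (sh) \<alpha> w where "l = Shared \<alpha> w" "\<alpha> \<in> shared_actions M"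
          "w \<in> Pi\<^sub>E (enabling M \<alpha>) (targets M \<alpha>)"
      by (auto simp: activities_def)
    then show "l \<in> (\<lambda>(P, \<alpha>, Q). Individual \<alpha> P Q) ` transitions M \<union>
        (\<Union>\<alpha>\<in>?S. Shared \<alpha> ` Pi\<^sub>E (enabling M \<alpha>) (targets M \<alpha>))"
    proof cases
      case ind
      then show ?thesis by force
    next
      case sh
      \<comment> \<open>A shared action is enabled somewhere, so it labels a transition. This bounds
        the number of shared actions, since \<open>shared_actions M\<close> is not explicitly
        required to be finite.\<close>
      have "\<alpha> \<in> ?S"
        using enabling_shared_nonempty[OF M sh(2)] by (force simp: enabling_def targets_def)
      then show ?thesis using sh by blast
    qed
  qed
  moreover have "finite (Pi\<^sub>E (enabling M \<alpha>) (targets M \<alpha>))" for \<alpha>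
    by (intro finite_PiE finite_enabling finite_targets M)
  ultimately show ?thesis
    using pepa_modelD(1)[OF M] by (elim finite_subset) auto
qed

lemma total_rate_nonneg:
  assumes "pepa_model M"
  shows "0 \<le> total_rate M \<alpha> P"
  unfolding total_rate_def
  by (rule sum_nonneg) (simp add: targets_def less_imp_le pepa_model_transitionD(4)[OF assms])

lemma branching_prob_nonneg:
  assumes "pepa_model M" "w \<in> Pi\<^sub>E (enabling M \<alpha>) (targets M \<alpha>)"
  shows "0 \<le> (\<Prod>P\<in>enabling M \<alpha>. rate M \<alpha> P (w P) / total_rate M \<alpha> P)"
proof (intro prod_nonneg ballI divide_nonneg_nonneg total_rate_nonneg assms(1))
  fix P assume "P \<in> enabling M \<alpha>"
  then have "(P, \<alpha>, w P) \<in> transitions M" using assms(2) by (auto simp: targets_def)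
  then show "0 \<le> rate M \<alpha> P (w P)" by (intro less_imp_le pepa_model_transitionD(4)[OF assms(1)])
qed

section \<open>Linear bounds on rate functions and on the right-hand side\<close>

lemma rate_fun_le_pre:
  assumes M: "pepa_model M" and l: "l \<in> activities M" and U: "U \<in> pre M l"
  shows "\<exists>c\<ge>0. \<forall>x. rate_fun M x l \<le> c * x U"
  using l unfolding activities_def
proof (elim UnE CollectE exE conjE)
  fix \<alpha> P Q assume "l = Individual \<alpha> P Q" "(P, \<alpha>, Q) \<in> transitions M"
  with pepa_model_transitionD[OF M this(2)] show ?thesis
    using U by (intro exI[of _ "rate M \<alpha> P Q"]) (simp add: mult.commute)
next
  fix \<alpha> w assume l: "l = Shared \<alpha> w" and w: "w \<in> Pi\<^sub>E (enabling M \<alpha>) (targets M \<alpha>)"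
  define p where "p = (\<Prod>P\<in>enabling M \<alpha>. rate M \<alpha> P (w P) / total_rate M \<alpha> P)"
  have p: "0 \<le> p" unfolding p_def using M w by (rule branching_prob_nonneg)
  show ?thesis
  \<comment> \<open>The minimum is at most its entry for \<open>U\<close>, and the factor
    \<open>p\<close> is nonnegative; hence this constant, which is independent of
    \<open>x\<close>.\<close>
  proof (intro exI[of _ "p * total_rate M \<alpha> U"] conjI allI)
    show "0 \<le> p * total_rate M \<alpha> U" using p total_rate_nonneg[OF M] by simp
    fix x
    have "Min ((\<lambda>P. x P * total_rate M \<alpha> P) ` enabling M \<alpha>) \<le> x U * total_rate M \<alpha> U"
      using U l finite_enabling[OF M] by (intro Min_le) auto
    then have "rate_fun M x l \<le> p * (x U * total_rate M \<alpha> U)"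
      using p by (simp add: l mult_left_mono flip: p_def)
    then show "rate_fun M x l \<le> p * total_rate M \<alpha> U * x U" by (simp add: mult_ac)
  qed
qed

lemma rate_fun_ge_neg_part:
  assumes M: "pepa_model M" and l: "l \<in> activities M"
  shows "\<exists>c\<ge>0. \<forall>x. - c * (\<Sum>P\<in>local_derivs M. max 0 (- x P)) \<le> rate_fun M x l"
proof -
  let ?S = "\<lambda>x. \<Sum>P\<in>local_derivs M. max 0 (- x P)"
  \<comment> \<open>A single entry is at worst \<open>r\<close> times its own negative part below
    zero, and that part is one summand of \<open>?S x\<close>.\<close>
  have ge: "- R * ?S x \<le> x P * r" if "P \<in> local_derivs M" "0 \<le> r" "r \<le> R"
    for P r R and x :: "local_deriv \<Rightarrow> real"
  proof -
    have "max 0 (- x P) \<le> ?S x"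
      by (rule member_le_sum[where f = "\<lambda>P. max 0 (- x P)"]) (use that finite_local_derivs in auto)
    then have "r * (- x P) \<le> r * ?S x" using that by (intro mult_left_mono) auto
    also have "\<dots> \<le> R * ?S x" using that by (intro mult_right_mono) (simp_all add: sum_nonneg)
    finally have "r * (- x P) \<le> R * ?S x" .
    then show ?thesis by (simp add: mult.commute)
  qed
  show ?thesis
    using l unfolding activities_def
  proof (elim UnE CollectE exE conjE)
    fix \<alpha> P Q assume "l = Individual \<alpha> P Q" "(P, \<alpha>, Q) \<in> transitions M"
    with pepa_model_transitionD[OF M this(2)] show ?thesis
      by (intro exI[of _ "rate M \<alpha> P Q"] conjI allI) (simp_all add: ge del: mult_minus_left)
  next
    fix \<alpha> w assume l: "l = Shared \<alpha> w" and w: "w \<in> Pi\<^sub>E (enabling M \<alpha>) (targets M \<alpha>)"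
      and \<alpha>: "\<alpha> \<in> shared_actions M"
    define p where "p = (\<Prod>P\<in>enabling M \<alpha>. rate M \<alpha> P (w P) / total_rate M \<alpha> P)"
    have p: "0 \<le> p" unfolding p_def using M w by (rule branching_prob_nonneg)
    \<comment> \<open>Summing the total rates gives one constant that serves whichever entry attains
      the minimum.\<close>
    define R where "R = (\<Sum>P\<in>enabling M \<alpha>. total_rate M \<alpha> P)"
    note E = finite_enabling[OF M, of \<alpha>] enabling_shared_nonempty[OF M \<alpha>] total_rate_nonneg[OF M]
    show ?thesis
    proof (intro exI[of _ "p * R"] conjI allI)
      show "0 \<le> p * R" using p E by (simp add: R_def sum_nonneg)
      fix x
      have "- R * ?S x \<le> Min ((\<lambda>P. x P * total_rate M \<alpha> P) ` enabling M \<alpha>)"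
      proof (rule Min.boundedI)
        fix a assume "a \<in> (\<lambda>P. x P * total_rate M \<alpha> P) ` enabling M \<alpha>"
        then obtain P where P: "P \<in> enabling M \<alpha>" "a = x P * total_rate M \<alpha> P" by auto
        have "total_rate M \<alpha> P \<le> R" unfolding R_def by (rule member_le_sum) (use P E in auto)
        then show "- R * ?S x \<le> a"
          unfolding P(2) using P(1) enabling_subset[OF M] E by (intro ge) auto
      qed (use E in auto)
      then have "p * (- R * ?S x) \<le> rate_fun M x l"
        using p by (simp add: l mult_left_mono flip: p_def del: mult_minus_left)
      then show "- (p * R) * ?S x \<le> rate_fun M x l" by (simp add: mult.assoc)
    qed
  qed
qed

text \<open>This is the growth hypothesis of \<open>quasi_positive_nonneg\<close>: consumption of
  \<open>U\<close> yields the \<open>K\<close> term and production of \<open>U\<close> the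
  \<open>L\<close> term.\<close>

lemma derived_ode_rhs_ge:
  assumes M: "pepa_model M"
  shows "\<exists>K\<ge>0. \<exists>L\<ge>0. \<forall>x. - K * x U - L * (\<Sum>P\<in>local_derivs M. max 0 (- x P))
    \<le> derived_ode_rhs M x U"
proof -
  let ?S = "\<lambda>x. \<Sum>P\<in>local_derivs M. max 0 (- x P)"
  let ?pre = "{l \<in> activities M. U \<in> pre M l}" and ?post = "{l \<in> activities M. U \<in> post M l}"
  \<comment> \<open>The constants are chosen per activity before \<open>x\<close> is fixed, so their
    finite sums are uniform in \<open>x\<close>.\<close>
  have "\<forall>l\<in>?pre. \<exists>c\<ge>0. \<forall>x. rate_fun M x l \<le> c * x U" using rate_fun_le_pre[OF M] by blast
  then obtain k where k: "\<And>l. l \<in> ?pre \<Longrightarrow> 0 \<le> k l \<and> (\<forall>x. rate_fun M x l \<le> k l * x U)"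
    by metis
  have "\<forall>l\<in>?post. \<exists>c\<ge>0. \<forall>x. - c * ?S x \<le> rate_fun M x l" using rate_fun_ge_neg_part[OF M] by blast
  then obtain c where c: "\<And>l. l \<in> ?post \<Longrightarrow> 0 \<le> c l \<and> (\<forall>x. - c l * ?S x \<le> rate_fun M x l)"
    by metis
  have "- (\<Sum>l\<in>?pre. k l) * x U - (\<Sum>l\<in>?post. c l) * ?S x \<le> derived_ode_rhs M x U" for x
  proof -
    have "(\<Sum>l\<in>?pre. rate_fun M x l) \<le> (\<Sum>l\<in>?pre. k l * x U)"
      by (rule sum_mono) (use k in blast)
    moreover have "(\<Sum>l\<in>?post. - c l * ?S x) \<le> (\<Sum>l\<in>?post. rate_fun M x l)"
      by (rule sum_mono) (use c in blast)
    ultimately show ?thesis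
      by (simp add: derived_ode_rhs_def sum_negf flip: sum_distrib_right)
  qed
  moreover have "0 \<le> (\<Sum>l\<in>?pre. k l)" by (rule sum_nonneg) (use k in blast)
  moreover have "0 \<le> (\<Sum>l\<in>?post. c l)" by (rule sum_nonneg) (use c in blast)
  ultimately show ?thesis by blast
qed

section \<open>Conservation of the population of each component type\<close>

lemma card_pre_eq_card_post:
  assumes M: "pepa_model M" and l: "l \<in> activities M"
  shows "card {U \<in> local_derivs M. fst U = i \<and> U \<in> pre M l} =
    card {U \<in> local_derivs M. fst U = i \<and> U \<in> post M l}"
  using l unfolding activities_def
proof (elim UnE CollectE exE conjE)
  fix \<alpha> P Q assume l: "l = Individual \<alpha> P Q" and "(P, \<alpha>, Q) \<in> transitions M"
  from pepa_model_transitionD[OF M this(2)] have "{U \<in> local_derivs M. fst U = i \<and> U \<in> pre M l} = (if fst P = i then {P} else {})"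
    "{U \<in> local_derivs M. fst U = i \<and> U \<in> post M l} = (if fst P = i then {Q} else {})"
    using l by auto
  then show ?thesis by simp
next
  fix \<alpha> w assume l: "l = Shared \<alpha> w" and w: "w \<in> Pi\<^sub>E (enabling M \<alpha>) (targets M \<alpha>)"
    and \<alpha>: "\<alpha> \<in> shared_actions M"
  have tr: "w P \<in> local_derivs M \<and> fst (w P) = fst P" if "P \<in> enabling M \<alpha>" for P
  proof -
    have "(P, \<alpha>, w P) \<in> transitions M" using w that by (auto simp: targets_def)
    from pepa_model_transitionD[OF M this] show ?thesis by simp
  qed
  have "{U \<in> local_derivs M. fst U = i \<and> U \<in> post M l} =
      w ` {U \<in> local_derivs M. fst U = i \<and> U \<in> pre M l}"
    using tr enabling_subset[OF M, of \<alpha>] by (auto simp: l)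
  \<comment> \<open>\<open>w\<close> preserves component types and the enabling local derivatives
    have distinct types, so equal images force equal arguments. Thus \<open>w\<close> is a bijection
    between the pre and post elements of type \<open>i\<close>.\<close>
  moreover have "inj_on w {U \<in> local_derivs M. fst U = i \<and> U \<in> pre M l}"
    by (rule inj_onI) (use tr bspec[OF pepa_modelD(3)[OF M] \<alpha>] in \<open>auto simp: l dest: inj_onD\<close>)
  ultimately show ?thesis by (simp add: card_image)
qed

text \<open>Double counting: after exchanging the sums, each activity contributes its rate times the
  number of its pre elements in the type, and the same number of post elements cancels this.\<close>

lemma sum_derived_ode_rhs_type:
  assumes M: "pepa_model M"
  shows "(\<Sum>U | U \<in> local_derivs M \<and> fst U = i. derived_ode_rhs M x U) = 0"
proof -
  let ?C = "{U. U \<in> local_derivs M \<and> fst U = i}"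
  have fin: "finite ?C" "finite (activities M)"
    using finite_local_derivs[of M] finite_activities[OF M] by auto
  have "(\<Sum>U\<in>?C. \<Sum>l | l \<in> activities M \<and> U \<in> pre M l. rate_fun M x l) =
      (\<Sum>l\<in>activities M. card {U \<in> local_derivs M. fst U = i \<and> U \<in> pre M l} * rate_fun M x l)"
    by (subst sum.swap_restrict[OF fin]) (simp add: conj_assoc)
  also have "\<dots> = (\<Sum>l\<in>activities M. card {U \<in> local_derivs M. fst U = i \<and> U \<in> post M l} * rate_fun M x l)"
    by (rule sum.cong) (use card_pre_eq_card_post[OF M] in auto)
  also have "\<dots> = (\<Sum>U\<in>?C. \<Sum>l | l \<in> activities M \<and> U \<in> post M l. rate_fun M x l)"
    by (subst sum.swap_restrict[OF fin]) (simp add: conj_assoc)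
  finally show ?thesis
    by (simp add: derived_ode_rhs_def sum.distrib sum_negf sum_subtractf)
qed

lemma population_conserved:
  assumes M: "pepa_model M" and ode: "satisfies_derived_odes M x"
    and i: "i \<in> {1..num_types M}" and t: "t \<ge> 0"
  shows "(\<Sum>j=1..num_derivs M i. x t (i, j)) = initial_population M x i"
proof -
  let ?C = "{U. U \<in> local_derivs M \<and> fst U = i}"
  define N where "N t = (\<Sum>U\<in>?C. x t U)" for t
  have "?C = Pair i ` {1..num_derivs M i}" using i by (auto simp: local_derivs_def)
  then have N: "N t = (\<Sum>j=1..num_derivs M i. x t (i, j))" for t
    unfolding N_def by (simp add: sum.reindex inj_on_def)
  have "(N has_real_derivative 0) (at t within {0..})" if "t \<ge> 0" for t
  proof -
    have "(N has_real_derivative (\<Sum>U\<in>?C. derived_ode_rhs M (x t) U)) (at t within {0..})"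
      unfolding N_def
      by (rule DERIV_sum) (use ode that in \<open>auto simp: satisfies_derived_odes_def\<close>)
    then show ?thesis by (simp add: sum_derived_ode_rhs_type[OF M])
  qed
  \<comment> \<open>With \<open>c = 0\<close>, Gronwall for \<open>N\<close> and for its negation
    gives the two inequalities between \<open>N t\<close> and \<open>N 0\<close>.\<close>
  from gronwall_halfline[OF this _ t, of 0] gronwall_halfline[OF DERIV_minus[OF this] _ t, of 0]
  have "N t = N 0" by simp
  then show ?thesis by (simp add: N initial_population_def)
qed

section \<open>Bounds for solutions of the derived equations\<close>

theorem theorem5:
  fixes M :: "'a pepa" and x :: "real \<Rightarrow> local_deriv \<Rightarrow> real"
  assumes "pepa_model M"
    and "satisfies_derived_odes M x"
    and "\<forall>U\<in>local_derivs M. 0 \<le> x 0 U"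
  shows "(\<forall>t\<ge>0. \<forall>i\<in>{1..num_types M}. \<forall>j\<in>{1..num_derivs M i}.
            0 \<le> x t (i, j) \<and> x t (i, j) \<le> initial_population M x i) \<and>
         ((\<forall>U\<in>local_derivs M. 0 < x 0 U) \<longrightarrow>
           (\<forall>t\<ge>0. \<forall>i\<in>{1..num_types M}. \<forall>j\<in>{1..num_derivs M i}.
              0 < x t (i, j) \<and>
              (2 \<le> num_derivs M i \<longrightarrow> x t (i, j) < initial_population M x i)))"
proof -
  note M = assms(1)
  let ?D = "local_derivs M"
  have ode: "((\<lambda>s. x s U) has_real_derivative derived_ode_rhs M (x t) U) (at t within {0..})"
    if "t \<ge> 0" "U \<in> ?D" for t U
    using assms(2) that by (simp add: satisfies_derived_odes_def)
  obtain K L where K: "\<And>U. 0 \<le> K U" and L: "\<And>U. 0 \<le> L U"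
    and ge: "\<And>U y. - K U * y U - L U * (\<Sum>P\<in>?D. max 0 (- y P)) \<le> derived_ode_rhs M y U"
    using derived_ode_rhs_ge[OF M] by metis
  have nonneg: "0 \<le> x t U" if "t \<ge> 0" "U \<in> ?D" for t U
    by (rule quasi_positive_nonneg[OF finite_local_derivs ode K L ge _ that]) (use assms(3) in auto)
  have pos: "0 < x t U" if "t \<ge> 0" "U \<in> ?D" "0 < x 0 U" for t U
  proof -
    \<comment> \<open>Nonnegativity makes the \<open>L\<close> term vanish. Gronwall then applies to
      \<open>- x\<close> with the constant \<open>- K U\<close>, so a positive initial value decays
      at most exponentially.\<close>
    have "- derived_ode_rhs M (x s) U \<le> - K U * - x s U" if "s \<ge> 0" for s
    proof -
      have "(\<Sum>P\<in>?D. max 0 (- x s P)) = 0" by (rule sum.neutral) (use nonneg[OF that] in auto)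
      then show ?thesis using ge[of U "x s"] by simp
    qed
    from gronwall_halfline[OF DERIV_minus[OF ode[OF _ that(2)]] this that(1)]
    have "x 0 U * exp (- K U * t) \<le> x t U" by simp
    then show ?thesis using that(3) by (smt (verit) exp_gt_zero mult_pos_pos)
  qed
  have D: "(i, j) \<in> ?D" if "i \<in> {1..num_types M}" "j \<in> {1..num_derivs M i}" for i j
    using that by (simp add: local_derivs_def)
  \<comment> \<open>Isolating one summand of the conserved population leaves the gap to the upper
    bound as a sum over the other local derivatives of the type.\<close>
  have upper: "x t (i, j) + (\<Sum>k\<in>{1..num_derivs M i} - {j}. x t (i, k)) = initial_population M x i"
    if "t \<ge> 0" "i \<in> {1..num_types M}" "j \<in> {1..num_derivs M i}" for t i j
    using population_conserved[OF M assms(2) that(2,1)]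
      sum.remove[OF _ that(3), of "\<lambda>j. x t (i, j)"] by simp
  show ?thesis
  proof (intro conjI impI allI ballI)
    fix t i j assume *: "(t::real) \<ge> 0" "i \<in> {1..num_types M}" "j \<in> {1..num_derivs M i}"
    show "0 \<le> x t (i, j)" using nonneg D * by blast
    have "0 \<le> (\<Sum>k\<in>{1..num_derivs M i} - {j}. x t (i, k))"
      by (rule sum_nonneg) (use nonneg[OF *(1)] D[OF *(2)] in auto)
    then show "x t (i, j) \<le> initial_population M x i" using upper[OF *] by linarith
    assume init: "\<forall>U\<in>?D. 0 < x 0 U"
    show "0 < x t (i, j)" using pos D * init by blast
    assume "2 \<le> num_derivs M i"
    \<comment> \<open>A second local derivative of the type, different from \<open>j\<close>: its
      positive value makes the gap strictly positive.\<close>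
    then have "(if j = 1 then 2 else 1) \<in> {1..num_derivs M i} - {j}" by auto
    then have "{1..num_derivs M i} - {j} \<noteq> {}" by blast
    then have "0 < (\<Sum>k\<in>{1..num_derivs M i} - {j}. x t (i, k))"
      by (intro sum_pos) (use pos[OF *(1)] D[OF *(2)] init in auto)
    then show "x t (i, j) < initial_population M x i" using upper[OF *] by linarith
  qed
qed

end
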